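(* Let $(Q_{n,k})$ be a regular B-representable family of polynomials, and for all integers $n,k$ put $Q_{n,k}:=B_{n,k}(Q_{1,1},Q_{2,1},\ldots)$ and $Q^{\perp}_{n,k}:=A_{n,k}(Q_{1,1},Q_{2,1},\ldots)$, with $B_{n,k},A_{n,k}$ the integer-indexed polynomials defined in the context. Then for all $n,k\in\mathbb{Z}$: $Q^{\perp}_{n,k}=(-1)^{n-k}Q_{-k,-n}$.
   Context: $\mathbb{K}$ is a field of characteristic zero. Binomial coefficients: for integers $m$ and $j\ge0$, $\binom mj=m(m-1)\cdots(m-j+1)/j!$; for $j<0$: $\binom mj=0$ if $m\ge0$, and for $m=-N<0$: $\binom{-N}{j}=0$ if $j>-N$, and $\binom{-N}{j}=\binom{-N}{-N-j}$ otherwise. Partial Bell polynomials for $n,k\ge0$: $B_{0,0}=1$, $B_{n,0}=0$ ($n\ge1$), $B_{n,k}=0$ ($k>n$), and for $1\le k\le n$, $B_{n,k}=\sum\frac{n!}{\prod_i r_i!(i!)^{r_i}}\prod_iX_i^{r_i}$ over non-negative integers with $\sum r_i=k$, $\sum ir_i=n$. Potential polynomials: for $m\ge0$ and $r\in\mathbb{Z}$, $\widehat P_{m,r}:=\sum_{j=0}^m r(r-1)\cdots(r-j+1)\,X_0^{r-j}B_{m,j}$ (Laurent polynomials in $X_0$), and $\widehat P_{m,r}:=0$ for $m<0$; reciprocal polynomials $\widehat R_m:=\widehat P_{m,-1}$. For arbitrary $n,k\in\mathbb{Z}$ the polynomials are (re)defined by $B_{n,k}:=\binom nk\widehat P_{n-k,k}(\tfrac{X_1}{1},\tfrac{X_2}{2},\ldots,\tfrac{X_{n-k+1}}{n-k+1})$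 and $A_{n,k}:=\binom{n-1}{k-1}\widehat P_{n-k,n}\big(\widehat R_0(\tfrac{X_1}1),\widehat R_1(\tfrac{X_1}1,\tfrac{X_2}2),\ldots,\widehat R_{n-k}(\tfrac{X_1}1,\ldots,\tfrac{X_{n-k+1}}{n-k+1})\big)$ (here $\widehat P_{m,r}(Y_0,\ldots,Y_m)$ means $X_i\mapsto Y_i$); for $n\ge k\ge1$ these agree with the Bell polynomials and with their orthogonal companions $A_{n,k}$ (the unique triangular family with $\sum_{j=k}^nA_{n,j}B_{j,k}=\delta_{nk}$). A family $(Q_{n,k})_{1\le k\le n}$ is B-representable if there are polynomials $H_j$ with $Q_{n,k}=B_{n,k}(H_1,\ldots,H_{n-k+1})$ for all $1\le k\le n$; it is regular if its lower triangular matrices are nonsingular (equivalently $Q_{1,1}$ is invertible). $P(H_1,H_2,\ldots)$ means substitution of $H_j$ for $X_j$. *)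

theory Defs
  imports
    "HOL-Library.Poly_Mapping"
    "HOL-Computational_Algebra.Fraction_Field"
    "HOL-Computational_Algebra.Polynomial_Factorial"
    "Jordan_Normal_Form.Determinant"
begin

text \<open>
  Laurent polynomials over \<open>'k\<close> in the indeterminates \<open>X\<^sub>0, X\<^sub>1, X\<^sub>2, \<dots>\<close>: a monomial is a finitely
  supported exponent vector \<open>nat \<Rightarrow>\<^sub>0 int\<close>, and multiplication is the convolution product.
  Ordinary polynomials are the elements all of whose exponents are non-negative.
\<close>

type_synonym 'k lpoly = "(nat \<Rightarrow>\<^sub>0 int) \<Rightarrow>\<^sub>0 'k"

text \<open>The field of rational functions, as the fraction field of the domain of Laurent polynomials.\<close>

type_synonym 'k ratfun = "'k lpoly fract"

definition const :: "'k::field_char_0 \<Rightarrow> 'k lpoly" where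
  "const c = Poly_Mapping.single 0 c"

definition Xpow :: "nat \<Rightarrow> int \<Rightarrow> 'k::field_char_0 lpoly" where
  "Xpow i e = Poly_Mapping.single (Poly_Mapping.single i e) 1"

abbreviation Xvar :: "nat \<Rightarrow> 'k::field_char_0 lpoly" where
  "Xvar i \<equiv> Xpow i 1"

subsection \<open>Substitution\<close>

text \<open>
  Integer powers in a commutative ring. For a negative exponent this is meaningful only at units; the
  value \<open>0\<close> of \<^term>\<open>unit_inv\<close> at non-units is a totalisation. In a field, \<^term>\<open>unit_inv\<close> is
  \<^term>\<open>inverse\<close>.
\<close>

definition unit_inv :: "'a::comm_ring_1 \<Rightarrow> 'a" where
  "unit_inv x = (if x dvd 1 then (THE y. x * y = 1) else 0)"

definition unit_powi :: "'a::comm_ring_1 \<Rightarrow> int \<Rightarrow> 'a" where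
  "unit_powi x e = (if 0 \<le> e then x ^ nat e else unit_inv x ^ nat (- e))"

text \<open>
  \<open>lsubst \<iota> H P\<close> is \<open>P(H\<^sub>0, H\<^sub>1, H\<^sub>2, \<dots>)\<close>, with values in a ring that receives the coefficients
  through \<open>\<iota>\<close>.
\<close>

definition lsubst :: "('k::field_char_0 \<Rightarrow> 'a::comm_ring_1) \<Rightarrow> (nat \<Rightarrow> 'a) \<Rightarrow> 'k lpoly \<Rightarrow> 'a" where
  "lsubst \<iota> H P =
     (\<Sum>m\<in>Poly_Mapping.keys P. \<iota> (Poly_Mapping.lookup P m) *
        (\<Prod>i\<in>Poly_Mapping.keys m. unit_powi (H i) (Poly_Mapping.lookup m i)))"

definition subst_poly :: "(nat \<Rightarrow> 'k lpoly) \<Rightarrow> 'k::field_char_0 lpoly \<Rightarrow> 'k lpoly" where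
  "subst_poly = lsubst const"

definition subst_rat :: "(nat \<Rightarrow> 'k ratfun) \<Rightarrow> 'k::field_char_0 lpoly \<Rightarrow> 'k ratfun" where
  "subst_rat = lsubst (\<lambda>c. to_fract (const c))"

subsection \<open>Bell, potential and reciprocal polynomials\<close>

definition ibinom :: "int \<Rightarrow> int \<Rightarrow> 'k::field_char_0" where
  "ibinom m j =
     (if 0 \<le> j then of_int m gchoose nat j
      else if 0 \<le> m then 0
      else if j > m then 0
      else of_int m gchoose nat (m - j))"

definition bell_exponents :: "nat \<Rightarrow> nat \<Rightarrow> (nat \<Rightarrow> nat) set" where
  "bell_exponents n k =
     {r. (\<forall>i. i \<notin> {1..n} \<longrightarrow> r i = 0) \<and> (\<Sum>i=1..n. r i) = k \<and> (\<Sum>i=1..n. i * r i) = n}"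

definition bell :: "nat \<Rightarrow> nat \<Rightarrow> 'k::field_char_0 lpoly" where
  "bell n k =
     (if n = 0 \<and> k = 0 then 1
      else if k = 0 \<or> n < k then 0
      else \<Sum>r\<in>bell_exponents n k.
             const (fact n / (\<Prod>i=1..n. fact (r i) * fact i ^ r i)) * (\<Prod>i=1..n. Xvar i ^ r i))"

definition potential :: "int \<Rightarrow> int \<Rightarrow> 'k::field_char_0 lpoly" where
  "potential m r =
     (if m < 0 then 0
      else \<Sum>j=0..nat m. const (\<Prod>i<j. of_int r - of_nat i) * Xpow 0 (r - int j) * bell (nat m) j)"

definition reciprocal :: "int \<Rightarrow> 'k::field_char_0 lpoly" where
  "reciprocal m = potential m (- 1)"

text \<open>The substitution \<open>X\<^sub>i \<mapsto> X\<^sub>i\<^sub>+\<^sub>1 / (i + 1)\<close>, i.e.\ \<open>P(X\<^sub>1/1, X\<^sub>2/2, \<dots>)\<close>.\<close>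

definition shift_div :: "nat \<Rightarrow> 'k::field_char_0 lpoly" where
  "shift_div i = const (1 / of_nat (i + 1)) * Xvar (i + 1)"

definition Bpoly :: "int \<Rightarrow> int \<Rightarrow> 'k::field_char_0 lpoly" where
  "Bpoly n k = const (ibinom n k) * subst_poly shift_div (potential (n - k) k)"

definition Apoly :: "int \<Rightarrow> int \<Rightarrow> 'k::field_char_0 lpoly" where
  "Apoly n k = const (ibinom (n - 1) (k - 1)) *
     subst_poly (\<lambda>i. subst_poly shift_div (reciprocal (int i))) (potential (n - k) n)"

subsection \<open>Families of polynomials\<close>

text \<open>A family \<open>Q\<close> is only looked at for indices \<open>1 \<le> k \<le> n\<close>.\<close>

definition B_representable :: "(nat \<Rightarrow> nat \<Rightarrow> 'k::field_char_0 lpoly) \<Rightarrow> bool" where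
  "B_representable Q \<longleftrightarrow>
     (\<exists>H :: nat \<Rightarrow> 'k lpoly. \<forall>n k. 1 \<le> k \<and> k \<le> n \<longrightarrow> Q n k = subst_poly H (bell n k))"

text \<open>Matrix indices start at \<open>0\<close>, hence the shift by one.\<close>

definition lower_matrix :: "(nat \<Rightarrow> nat \<Rightarrow> 'k::field_char_0 lpoly) \<Rightarrow> nat \<Rightarrow> 'k lpoly mat" where
  "lower_matrix Q N = mat N N (\<lambda>(i, j). if j \<le> i then Q (i + 1) (j + 1) else 0)"

text \<open>
  Nonsingular means nonzero determinant, i.e.\ invertible over the field of rational functions;
  for a B-representable family, equivalently, \<open>Q 1 1\<close> is invertible there.
\<close>

definition regular :: "(nat \<Rightarrow> nat \<Rightarrow> 'k::field_char_0 lpoly) \<Rightarrow> bool" where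
  "regular Q \<longleftrightarrow> (\<forall>N\<ge>1. det (lower_matrix Q N) \<noteq> 0)"

text \<open>
  For integer indices negative powers of \<open>Q 1 1\<close> occur, so the extended families take values in the
  rational functions. The indeterminate \<open>X\<^sub>0\<close> occurs neither in \<^term>\<open>Bpoly n k\<close> nor in \<^term>\<open>Apoly n k\<close>, so
  \<open>Q 0 1\<close> is irrelevant.
\<close>

definition Q_ext :: "(nat \<Rightarrow> nat \<Rightarrow> 'k::field_char_0 lpoly) \<Rightarrow> int \<Rightarrow> int \<Rightarrow> 'k ratfun" where
  "Q_ext Q n k = subst_rat (\<lambda>j. to_fract (Q j 1)) (Bpoly n k)"

definition Q_perp :: "(nat \<Rightarrow> nat \<Rightarrow> 'k::field_char_0 lpoly) \<Rightarrow> int \<Rightarrow> int \<Rightarrow> 'k ratfun" where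
  "Q_perp Q n k = subst_rat (\<lambda>j. to_fract (Q j 1)) (Apoly n k)"

end

theory Submission
  imports Defs "HOL-Computational_Algebra.Formal_Power_Series"
begin

text \<open>
  For \<open>f = \<Sum>\<^sub>i y\<^sub>i x\<^sup>i / i!\<close> with \<open>y\<^sub>0 \<noteq> 0\<close>, the potential polynomial \<open>P\<^sub>m\<^sub>,\<^sub>r(y)\<close> is \<open>m!\<close> times the
  coefficient of \<open>x\<^sup>m\<close> in \<open>f\<^sup>r\<close>: expand \<open>f\<^sup>r = y\<^sub>0\<^sup>r (1 + g)\<^sup>r\<close> by the binomial series and \<open>g\<^sup>j\<close> by the
  multinomial theorem. Hence the reciprocal polynomials are the coefficients of \<open>1 / f\<close>, and
  inserting them into \<open>P\<^sub>m\<^sub>,\<^sub>n\<close> gives \<open>P\<^sub>m\<^sub>,\<^sub>-\<^sub>n\<close>. With \<open>m = n - k\<close> and \<open>y\<^sub>i = Q\<^sub>i\<^sub>+\<^sub>1\<^sub>,\<^sub>1 / (i + 1)\<close> the two sides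
  of the claim then differ only in their binomial factors, which agree by reflection.
\<close>

no_notation vec_index (infixl \<open>$\<close> 100)
unbundle fps_syntax

section \<open>Integer powers of units\<close>

lemma unit_inv_eqI:
  assumes "x * y = 1"
  shows "unit_inv x = y"
proof -
  have "z = y" if "x * z = 1" for z
    by (metis assms that mult.assoc mult.commute mult_1)
  with assms have "(THE z. x * z = 1) = y"
    by blast
  moreover have "x dvd 1"
    using assms by (metis dvdI)
  ultimately show ?thesis
    by (simp add: unit_inv_def)
qed

lemma mult_unit_inv: "x dvd 1 \<Longrightarrow> x * unit_inv x = 1"
  by (metis dvdE unit_inv_eqI)

lemma unit_powi_0 [simp]: "unit_powi x 0 = 1"
  and unit_powi_1 [simp]: "unit_powi x 1 = x"
  and unit_powi_minus_1 [simp]: "unit_powi x (- 1) = unit_inv x"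
  by (simp_all add: unit_powi_def)

lemma power_mult_inverse_power:
  fixes x y :: "'a::comm_ring_1"
  assumes "x * y = 1"
  shows "x ^ a * y ^ b = (if b \<le> a then x ^ (a - b) else y ^ (b - a))"
proof (cases "b \<le> a")
  case True
  then have "x ^ a = x ^ (a - b) * x ^ b"
    by (simp flip: power_add)
  then have "x ^ a * y ^ b = x ^ (a - b) * (x * y) ^ b"
    by (simp add: power_mult_distrib mult_ac)
  with True assms show ?thesis by simp
next
  case False
  then have "y ^ b = y ^ (b - a) * y ^ a"
    by (simp flip: power_add)
  then have "x ^ a * y ^ b = y ^ (b - a) * (x * y) ^ a"
    by (simp add: power_mult_distrib mult_ac)
  with False assms show ?thesis by simp
qed

text \<open>The disjunction mirrors the exponents of a Laurent monomial: they may be negative only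
  at variables with invertible values.\<close>

lemma unit_powi_add:
  assumes "x dvd 1 \<or> 0 \<le> d \<and> 0 \<le> e"
  shows "unit_powi x (d + e) = unit_powi x d * unit_powi x e"
proof (cases "0 \<le> d \<and> 0 \<le> e")
  case True
  then show ?thesis
    by (simp add: unit_powi_def nat_add_distrib power_add)
next
  case False
  with assms have xy: "x * unit_inv x = 1"
    by (simp add: mult_unit_inv)
  note pm = power_mult_inverse_power[OF xy]
  consider "d < 0" "e < 0" | "0 \<le> d" "e < 0" | "d < 0" "0 \<le> e"
    using False by linarith
  then show ?thesis
  proof cases
    case 1
    then have "nat (- (d + e)) = nat (- d) + nat (- e)" by simp
    with 1 show ?thesis
      by (simp add: unit_powi_def power_add del: minus_add_distrib)
  next
    case 2
    then show ?thesis
      by (auto simp: unit_powi_def pm nat_diff_distrib intro!: arg_cong2[of _ _ _ _ power])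
  next
    case 3
    then show ?thesis
      by (subst mult.commute)
        (auto simp: unit_powi_def pm nat_diff_distrib intro!: arg_cong2[of _ _ _ _ power])
  qed
qed

lemma unit_powi_uminus:
  assumes "x dvd 1"
  shows "unit_powi (unit_inv x) e = unit_powi x (- e)"
proof -
  have "unit_inv (unit_inv x) = x"
    using mult_unit_inv[OF assms] by (intro unit_inv_eqI) (simp add: mult.commute)
  then show ?thesis
    by (simp add: unit_powi_def)
qed

lemma unit_powi_field: "unit_powi (x :: 'a::field) e = x powi e"
proof -
  have "unit_inv x = inverse x"
  proof (cases "x = 0")
    case False
    then show ?thesis by (intro unit_inv_eqI) simp
  qed (simp add: unit_inv_def)
  then show ?thesis
    by (simp add: unit_powi_def power_int_def)
qed

text \<open>\<open>G (- 1)\<close> is inverse to \<open>G 1\<close>, so a homomorphism from the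
  additive integers is determined by its value at 1. This identifies the binomial series with
  integer powers, negative exponents included.\<close>

lemma homomorphism_eq_unit_powi:
  assumes add: "\<And>d e. G (d + e) = G d * G e" and zero: "G 0 = 1"
  shows "G e = unit_powi (G 1 :: 'a::comm_ring_1) e"
proof -
  have nat: "G (of_nat n * d) = G d ^ n" for n d
    by (induction n) (simp_all add: add zero algebra_simps)
  have "unit_inv (G 1) = G (- 1)"
    using add[of 1 "- 1"] zero by (intro unit_inv_eqI) simp
  then show ?thesis
    using nat[of "nat e" 1] nat[of "nat (- e)" "- 1"]
    by (cases "0 \<le> e") (simp_all add: unit_powi_def)
qed


section \<open>Substitution as a ring homomorphism\<close>

text \<open>
  Substitution is multiplicative only where negative exponents meet invertible values, hence
  the subring of Laurent polynomials whose negative exponents are confined to the variables in \<open>S\<close>.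
\<close>

definition lring :: "nat set \<Rightarrow> 'k::field_char_0 lpoly set" where
  "lring S = {P. \<forall>m\<in>Poly_Mapping.keys P. \<forall>i. i \<notin> S \<longrightarrow> 0 \<le> Poly_Mapping.lookup m i}"

lemma lring_single:
  "(\<And>i. i \<notin> S \<Longrightarrow> 0 \<le> Poly_Mapping.lookup m i) \<Longrightarrow> Poly_Mapping.single m c \<in> lring S"
  by (auto simp: lring_def)

lemma lring_const: "const c \<in> lring S"
  by (auto simp: const_def intro!: lring_single)

lemma lring_Xpow: "i \<in> S \<or> 0 \<le> e \<Longrightarrow> Xpow i e \<in> lring S"
  by (auto simp: Xpow_def lookup_single when_def intro!: lring_single)

lemma lring_0: "0 \<in> lring S"
  by (simp add: lring_def)

lemma lring_1: "1 \<in> lring S"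
  using lring_single[of S 0 1] by simp

lemma lring_add: "P \<in> lring S \<Longrightarrow> Q \<in> lring S \<Longrightarrow> P + Q \<in> lring S"
  using Poly_Mapping.keys_add[of P Q] by (fastforce simp: lring_def)

lemma lring_mult: "P \<in> lring S \<Longrightarrow> Q \<in> lring S \<Longrightarrow> P * Q \<in> lring S"
  using Poly_Mapping.keys_mult[of P Q] by (fastforce simp: lring_def lookup_add)

lemma lring_sum: "(\<And>x. x \<in> A \<Longrightarrow> f x \<in> lring S) \<Longrightarrow> sum f A \<in> lring S"
  by (induction A rule: infinite_finite_induct) (auto intro: lring_0 lring_add)

lemma lring_prod: "(\<And>x. x \<in> A \<Longrightarrow> f x \<in> lring S) \<Longrightarrow> prod f A \<in> lring S"
  by (induction A rule: infinite_finite_induct) (auto intro: lring_1 lring_mult)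

lemma lring_power: "P \<in> lring S \<Longrightarrow> P ^ n \<in> lring S"
  by (induction n) (auto intro: lring_1 lring_mult)

lemmas lring_intros =
  lring_const lring_Xpow lring_0 lring_1 lring_add lring_mult lring_sum lring_prod lring_power

lemma poly_mapping_sum_single:
  "(\<Sum>m\<in>Poly_Mapping.keys P. Poly_Mapping.single m (Poly_Mapping.lookup P m)) = P"
  by (intro poly_mapping_eqI)
    (auto simp: lookup_sum lookup_single when_def sum.delta' in_keys_iff)

definition eval_monom :: "(nat \<Rightarrow> 'a::comm_ring_1) \<Rightarrow> (nat \<Rightarrow>\<^sub>0 int) \<Rightarrow> 'a" where
  "eval_monom H m = (\<Prod>i\<in>Poly_Mapping.keys m. unit_powi (H i) (Poly_Mapping.lookup m i))"

lemma eval_monom_superset: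
  assumes "finite A" "Poly_Mapping.keys m \<subseteq> A"
  shows "eval_monom H m = (\<Prod>i\<in>A. unit_powi (H i) (Poly_Mapping.lookup m i))"
  unfolding eval_monom_def
  by (rule prod.mono_neutral_left) (use assms in \<open>auto simp: in_keys_iff\<close>)

lemma eval_monom_add:
  assumes "\<And>i. \<not> H i dvd 1 \<Longrightarrow> 0 \<le> Poly_Mapping.lookup m i \<and> 0 \<le> Poly_Mapping.lookup m' i"
  shows "eval_monom H (m + m') = eval_monom H m * eval_monom H m'"
proof -
  let ?A = "Poly_Mapping.keys m \<union> Poly_Mapping.keys m'"
  have "eval_monom H (m + m') = (\<Prod>i\<in>?A. unit_powi (H i) (Poly_Mapping.lookup (m + m') i))"
    by (rule eval_monom_superset) (auto dest: subsetD[OF Poly_Mapping.keys_add])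
  also have "\<dots> = (\<Prod>i\<in>?A. unit_powi (H i) (Poly_Mapping.lookup m i)) *
      (\<Prod>i\<in>?A. unit_powi (H i) (Poly_Mapping.lookup m' i))"
    unfolding prod.distrib[symmetric] lookup_add
    by (intro prod.cong refl unit_powi_add) (use assms in blast)
  also have "\<dots> = eval_monom H m * eval_monom H m'"
    by (simp flip: eval_monom_superset)
  finally show ?thesis .
qed

lemma lsubst_eval_monom:
  "lsubst \<iota> H P =
    (\<Sum>m\<in>Poly_Mapping.keys P. \<iota> (Poly_Mapping.lookup P m) * eval_monom H m)"
  by (simp add: lsubst_def eval_monom_def)

text \<open>Substitution takes values both in Laurent polynomials (\<open>const\<close>) and in
  rational functions (\<open>to_fract (const c)\<close>); an abstract coefficient map serves
  both.\<close>

locale coeff_hom = comm_ring_hom \<iota> for \<iota> :: "'k::field_char_0 \<Rightarrow> 'a::comm_ring_1"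
begin

lemma lsubst_superset:
  assumes "finite A" "Poly_Mapping.keys P \<subseteq> A"
  shows "lsubst \<iota> H P = (\<Sum>m\<in>A. \<iota> (Poly_Mapping.lookup P m) * eval_monom H m)"
  unfolding lsubst_eval_monom
  by (rule sum.mono_neutral_left) (use assms in \<open>auto simp: in_keys_iff\<close>)

lemma lsubst_single: "lsubst \<iota> H (Poly_Mapping.single m c) = \<iota> c * eval_monom H m"
  by (simp add: lsubst_eval_monom)

lemma lsubst_const: "lsubst \<iota> H (const c) = \<iota> c"
  by (simp add: const_def lsubst_single eval_monom_def)

lemma lsubst_1: "lsubst \<iota> H 1 = 1"
  using lsubst_const[of H 1] by (simp add: const_def)

lemma lsubst_Xpow: "lsubst \<iota> H (Xpow i e) = unit_powi (H i) e"
  by (cases "e = 0") (simp_all add: Xpow_def lsubst_single lsubst_1 eval_monom_def)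

lemma lsubst_0: "lsubst \<iota> H 0 = 0"
  by (simp add: lsubst_def)

lemma lsubst_add: "lsubst \<iota> H (P + Q) = lsubst \<iota> H P + lsubst \<iota> H Q"
proof -
  let ?A = "Poly_Mapping.keys P \<union> Poly_Mapping.keys Q"
  have "lsubst \<iota> H (P + Q) = (\<Sum>m\<in>?A. \<iota> (Poly_Mapping.lookup (P + Q) m) * eval_monom H m)"
    by (rule lsubst_superset) (auto dest: subsetD[OF Poly_Mapping.keys_add])
  also have "\<dots> = lsubst \<iota> H P + lsubst \<iota> H Q"
    by (simp add: lookup_add hom_add distrib_right sum.distrib lsubst_superset[of ?A])
  finally show ?thesis .
qed

lemma lsubst_sum: "lsubst \<iota> H (sum f A) = (\<Sum>x\<in>A. lsubst \<iota> H (f x))"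
  by (induction A rule: infinite_finite_induct) (simp_all add: lsubst_0 lsubst_add)

end

locale coeff_hom_units = coeff_hom \<iota>
  for \<iota> :: "'k::field_char_0 \<Rightarrow> 'a::comm_ring_1" +
  fixes S :: "nat set" and H :: "nat \<Rightarrow> 'a"
  assumes units: "i \<in> S \<Longrightarrow> H i dvd 1"
begin

text \<open>By additivity only products of monomials matter. Exponents outside \<open>S\<close> are
  non-negative and values inside \<open>S\<close> are units, so \<open>eval_monom_add\<close>
  applies.\<close>

lemma lsubst_mult:
  assumes "P \<in> lring S" "Q \<in> lring S"
  shows "lsubst \<iota> H (P * Q) = lsubst \<iota> H P * lsubst \<iota> H Q"
proof -
  let ?P = "Poly_Mapping.lookup P" and ?Q = "Poly_Mapping.lookup Q"
  have "P * Q = (\<Sum>m\<in>Poly_Mapping.keys P. Poly_Mapping.single m (?P m)) *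
      (\<Sum>m\<in>Poly_Mapping.keys Q. Poly_Mapping.single m (?Q m))"
    by (simp only: poly_mapping_sum_single)
  also have "\<dots> = (\<Sum>m\<in>Poly_Mapping.keys P. \<Sum>m'\<in>Poly_Mapping.keys Q.
      Poly_Mapping.single (m + m') (?P m * ?Q m'))"
    by (simp add: sum_product mult_single)
  finally have "lsubst \<iota> H (P * Q) = (\<Sum>m\<in>Poly_Mapping.keys P. \<Sum>m'\<in>Poly_Mapping.keys Q.
      \<iota> (?P m * ?Q m') * eval_monom H (m + m'))"
    by (simp add: lsubst_sum lsubst_single)
  also have "\<dots> = (\<Sum>m\<in>Poly_Mapping.keys P. \<Sum>m'\<in>Poly_Mapping.keys Q.
      (\<iota> (?P m) * eval_monom H m) * (\<iota> (?Q m') * eval_monom H m'))"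
  proof (intro sum.cong refl)
    fix m m'
    assume "m \<in> Poly_Mapping.keys P" "m' \<in> Poly_Mapping.keys Q"
    then have "eval_monom H (m + m') = eval_monom H m * eval_monom H m'"
      using assms units by (intro eval_monom_add) (unfold lring_def, blast)
    then show "\<iota> (?P m * ?Q m') * eval_monom H (m + m') =
        (\<iota> (?P m) * eval_monom H m) * (\<iota> (?Q m') * eval_monom H m')"
      by (simp add: hom_mult mult_ac)
  qed
  also have "\<dots> = lsubst \<iota> H P * lsubst \<iota> H Q"
    by (simp add: lsubst_eval_monom sum_product)
  finally show ?thesis .
qed

lemma lsubst_prod:
  "(\<And>x. x \<in> A \<Longrightarrow> f x \<in> lring S) \<Longrightarrow> lsubst \<iota> H (prod f A) = (\<Prod>x\<in>A. lsubst \<iota> H (f x))"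
  by (induction A rule: infinite_finite_induct) (simp_all add: lsubst_1 lsubst_mult lring_prod)

lemma lsubst_power: "P \<in> lring S \<Longrightarrow> lsubst \<iota> H (P ^ n) = lsubst \<iota> H P ^ n"
  by (induction n) (simp_all add: lsubst_1 lsubst_mult lring_power)

text \<open>The inverse of \<open>P\<close> has to lie in \<open>lring S\<close> as well, because
  substitution must respect the product \<open>P * P' = 1\<close>.\<close>

lemma lsubst_unit_powi:
  assumes "P \<in> lring S" and "0 \<le> e \<or> (\<exists>P'\<in>lring S. P * P' = 1)"
  shows "unit_powi P e \<in> lring S" "lsubst \<iota> H (unit_powi P e) = unit_powi (lsubst \<iota> H P) e"
proof -
  have "unit_powi P e \<in> lring S \<and> lsubst \<iota> H (unit_powi P e) = unit_powi (lsubst \<iota> H P) e"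
  proof (cases "0 \<le> e")
    case True
    then show ?thesis
      using assms by (simp add: unit_powi_def lring_power lsubst_power)
  next
    case False
    then obtain P' where P': "P' \<in> lring S" "P * P' = 1"
      using assms by blast
    then have "lsubst \<iota> H P * lsubst \<iota> H P' = 1"
      using lsubst_mult[of P P'] assms lsubst_1 by simp
    with P' have "unit_inv P = P'" "unit_inv (lsubst \<iota> H P) = lsubst \<iota> H P'"
      by (auto intro: unit_inv_eqI)
    then show ?thesis
      using False P' by (simp add: unit_powi_def lring_power lsubst_power)
  qed
  then show "unit_powi P e \<in> lring S" "lsubst \<iota> H (unit_powi P e) = unit_powi (lsubst \<iota> H P) e"
    by blast+
qed

text \<open>Nested substitutions collapse into one. Negative exponents of \<open>P\<close> occur
  only at indices in \<open>T\<close>, where \<open>G i\<close> has an inverse that \<open>H\<close>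
  can evaluate.\<close>

lemma lsubst_subst_poly:
  assumes G: "\<And>i. G i \<in> lring S"
    and G_unit: "\<And>i. i \<in> T \<Longrightarrow> \<exists>P'\<in>lring S. G i * P' = 1"
    and P: "P \<in> lring T"
  shows "subst_poly G P \<in> lring S"
    "lsubst \<iota> H (subst_poly G P) = lsubst \<iota> (\<lambda>i. lsubst \<iota> H (G i)) P"
proof -
  have *: "0 \<le> Poly_Mapping.lookup m i \<or> (\<exists>P'\<in>lring S. G i * P' = 1)"
    if "m \<in> Poly_Mapping.keys P" for m i
    using that P G_unit by (auto simp: lring_def)
  have mono: "eval_monom G m \<in> lring S" if "m \<in> Poly_Mapping.keys P" for m
    unfolding eval_monom_def
    by (intro lring_prod lsubst_unit_powi(1) G *[OF that])
  then show "subst_poly G P \<in> lring S"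
    unfolding subst_poly_def lsubst_eval_monom by (intro lring_sum lring_mult lring_const)
  have "lsubst \<iota> H (eval_monom G m) = eval_monom (\<lambda>i. lsubst \<iota> H (G i)) m"
    if "m \<in> Poly_Mapping.keys P" for m
    unfolding eval_monom_def
    by (subst lsubst_prod) (simp_all add: lsubst_unit_powi G *[OF that])
  with mono show "lsubst \<iota> H (subst_poly G P) = lsubst \<iota> (\<lambda>i. lsubst \<iota> H (G i)) P"
    unfolding subst_poly_def lsubst_eval_monom[of _ _ P]
    by (simp add: lsubst_sum lsubst_mult lring_const lsubst_const)
qed

end


section \<open>Powers of formal power series\<close>

definition divided_power :: "'a::field_char_0 fps \<Rightarrow> nat \<Rightarrow> 'a fps" where
  "divided_power f n = fps_const (1 / fact n) * f ^ n"

text \<open>The factor \<open>1 / fact n\<close> absorbs the binomial coefficients, so the binomial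
  theorem becomes a plain convolution that iterates easily.\<close>

lemma divided_power_add:
  "divided_power (f + g) n = (\<Sum>k\<le>n. divided_power f k * divided_power g (n - k))"
proof -
  have "divided_power (f + g) n =
      (\<Sum>k\<le>n. fps_const (1 / fact n) * (of_nat (n choose k) * f ^ k * g ^ (n - k)))"
    by (simp add: divided_power_def binomial_ring sum_distrib_left)
  also have "\<dots> = (\<Sum>k\<le>n. divided_power f k * divided_power g (n - k))"
  proof (intro sum.cong refl)
    fix k assume "k \<in> {..n}"
    then have "(1 / fact n) * of_nat (n choose k) = (1 / fact k) * (1 / fact (n - k) :: 'a)"
      by (simp add: binomial_fact)
    then have "fps_const (1 / fact n) * of_nat (n choose k) =
        fps_const (1 / fact k) * fps_const (1 / fact (n - k) :: 'a)"
      by (simp add: fps_of_nat [symmetric])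
    then show "fps_const (1 / fact n) * (of_nat (n choose k) * f ^ k * g ^ (n - k)) =
        divided_power f k * divided_power g (n - k)"
      unfolding divided_power_def by (metis (no_types, lifting) mult.assoc mult.left_commute)
  qed
  finally show ?thesis .
qed

definition weak_compositions :: "'i set \<Rightarrow> nat \<Rightarrow> ('i \<Rightarrow> nat) set" where
  "weak_compositions A n = {r. (\<forall>i. i \<notin> A \<longrightarrow> r i = 0) \<and> sum r A = n}"

lemma weak_compositions_empty: "weak_compositions {} n = (if n = 0 then {\<lambda>_. 0} else {})"
  by (auto simp: weak_compositions_def)

lemma finite_weak_compositions:
  assumes "finite A"
  shows "finite (weak_compositions A n)"
proof -
  have "weak_compositions A n \<subseteq> {r. \<forall>i. (i \<in> A \<longrightarrow> r i \<in> {..n}) \<and> (i \<notin> A \<longrightarrow> r i = 0)}"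
    using assms by (auto simp: weak_compositions_def member_le_sum)
  then show ?thesis
    by (rule finite_subset) (intro finite_set_of_finite_funs assms finite_atMost)
qed

text \<open>The multinomial theorem: induction on the index set, splitting off one summand by
  \<open>divided_power_add\<close>.\<close>

lemma divided_power_sum:
  assumes "finite A"
  shows "divided_power (sum f A) n = (\<Sum>r\<in>weak_compositions A n. \<Prod>i\<in>A. divided_power (f i) (r i))"
  using assms
proof (induction A arbitrary: n rule: finite_induct)
  case empty
  show ?case
    by (simp add: divided_power_def power_0_left weak_compositions_empty)
next
  case (insert x A)
  have "divided_power (sum f (insert x A)) n =
      (\<Sum>(k, s)\<in>Sigma {..n} (\<lambda>k. weak_compositions A (n - k)).
        divided_power (f x) k * (\<Prod>i\<in>A. divided_power (f i) (s i)))"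
    using insert by (simp add: divided_power_add sum_distrib_left sum.Sigma finite_weak_compositions)
  also have "\<dots> = (\<Sum>r\<in>weak_compositions (insert x A) n.
      \<Prod>i\<in>insert x A. divided_power (f i) (r i))"
  \<comment> \<open>The exponent \<open>k\<close> of the new index is stored as \<open>r x\<close>;
    resetting it to 0, the value prescribed outside \<open>A\<close>, recovers the composition of
    the rest.\<close>
  proof (rule sum.reindex_bij_witness[where i = "\<lambda>r. (r x, r(x := 0))" and j = "\<lambda>(k, s). s(x := k)"])
    fix p assume "p \<in> Sigma {..n} (\<lambda>k. weak_compositions A (n - k))"
    then obtain k s where p: "p = (k, s)" "k \<le> n" "s \<in> weak_compositions A (n - k)"
      by auto
    have sA: "sum (s(x := k)) A = sum s A" "(\<Prod>i\<in>A. divided_power (f i) ((s(x := k)) i)) =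
        (\<Prod>i\<in>A. divided_power (f i) (s i))"
      using insert by (auto intro!: sum.cong prod.cong)
    show "(\<lambda>r. (r x, r(x := 0))) ((\<lambda>(k, s). s(x := k)) p) = p"
      using p insert by (auto simp: weak_compositions_def)
    show "(\<lambda>(k, s). s(x := k)) p \<in> weak_compositions (insert x A) n"
      using p insert sA by (auto simp: weak_compositions_def)
    show "(\<Prod>i\<in>insert x A. divided_power (f i) (((\<lambda>(k, s). s(x := k)) p) i)) =
        (case p of (k, s) \<Rightarrow> divided_power (f x) k * (\<Prod>i\<in>A. divided_power (f i) (s i)))"
      using p insert sA by simp
  next
    fix r assume r: "r \<in> weak_compositions (insert x A) n"
    have "sum (r(x := 0)) A = sum r A"
      using insert by (auto intro!: sum.cong)
    then show "(r x, r(x := 0)) \<in> Sigma {..n} (\<lambda>k. weak_compositions A (n - k))"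
      using r insert by (auto simp: weak_compositions_def)
  qed auto
  finally show ?case .
qed

lemma prod_fps_const: "(\<Prod>i\<in>A. fps_const (c i)) = fps_const (\<Prod>i\<in>A. c i :: 'a::comm_ring_1)"
  by (induction A rule: infinite_finite_induct) simp_all

text \<open>This allows a series to be truncated to a finite sum, to which the multinomial theorem
  applies.\<close>

lemma fps_power_nth_cong:
  fixes f g :: "'a::comm_ring_1 fps"
  assumes "\<And>i. i \<le> m \<Longrightarrow> f $ i = g $ i"
  shows "(f ^ n) $ m = (g ^ n) $ m"
  using assms
proof (induction n arbitrary: m)
  case (Suc n)
  then have "(f ^ n) $ i = (g ^ n) $ i" if "i \<le> m" for i
    using that by (meson order.trans)
  with Suc.prems show ?case
    by (simp add: fps_mult_nth)
qed simp

section \<open>Coefficients of powers of a series without constant term\<close>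

lemma bell_exponents_eq:
  "bell_exponents m n = {r \<in> weak_compositions {1..m} n. (\<Sum>i=1..m. i * r i) = m}"
  by (auto simp: bell_exponents_def weak_compositions_def)

text \<open>After truncation at degree \<open>m\<close>, each composition \<open>r\<close>
  contributes a single monomial of degree \<open>\<Sum>i. i * r i\<close>; extracting the
  coefficient at \<open>m\<close> leaves exactly the Bell exponents.\<close>

lemma fps_power_nth_bell_exponents:
  fixes c :: "nat \<Rightarrow> 'a::field_char_0"
  assumes "c 0 = 0"
  shows "(Abs_fps c ^ n) $ m =
    fact n * (\<Sum>r\<in>bell_exponents m n. \<Prod>i=1..m. c i ^ r i / fact (r i))"
proof -
  let ?t = "\<lambda>i. fps_const (c i) * fps_X ^ i"
  have "Abs_fps c $ i = (\<Sum>i=1..m. ?t i) $ i" if "i \<le> m" for i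
    using that assms by (cases "i = 0") (auto simp: fps_sum_nth fps_X_power_nth if_distrib cong: if_cong)
  then have "(Abs_fps c ^ n) $ m = ((\<Sum>i=1..m. ?t i) ^ n) $ m"
    by (rule fps_power_nth_cong)
  also have "\<dots> = fact n * (divided_power (\<Sum>i=1..m. ?t i) n $ m)"
    by (simp add: divided_power_def)
  also have "divided_power (\<Sum>i=1..m. ?t i) n $ m =
      (\<Sum>r\<in>weak_compositions {1..m} n. (\<Prod>i=1..m. divided_power (?t i) (r i)) $ m)"
    by (simp add: divided_power_sum fps_sum_nth)
  also have "\<dots> = (\<Sum>r\<in>weak_compositions {1..m} n.
      if (\<Sum>i=1..m. i * r i) = m then \<Prod>i=1..m. c i ^ r i / fact (r i) else 0)"
  proof (intro sum.cong refl)
    fix r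
    have "divided_power (?t i) (r i) = fps_const (c i ^ r i / fact (r i)) * fps_X ^ (i * r i)" for i
      by (simp add: divided_power_def power_mult_distrib power_mult fps_const_power mult.assoc [symmetric])
    then have "(\<Prod>i=1..m. divided_power (?t i) (r i)) =
        fps_const (\<Prod>i=1..m. c i ^ r i / fact (r i)) * fps_X ^ (\<Sum>i=1..m. i * r i)"
      by (simp add: prod.distrib power_sum prod_fps_const del: fps_const_divide)
    then show "(\<Prod>i=1..m. divided_power (?t i) (r i)) $ m =
        (if (\<Sum>i=1..m. i * r i) = m then \<Prod>i=1..m. c i ^ r i / fact (r i) else 0)"
      by (auto simp: fps_X_power_nth)
  qed
  also have "\<dots> = (\<Sum>r\<in>bell_exponents m n. \<Prod>i=1..m. c i ^ r i / fact (r i))"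
    unfolding bell_exponents_eq
    by (rule sum.inter_filter [symmetric]) (simp add: finite_weak_compositions)
  finally show ?thesis .
qed

section \<open>Integer powers by the binomial series\<close>

lemma fps_dvd_1: "f $ 0 \<noteq> (0 :: 'a::field) \<Longrightarrow> f dvd 1"
  by (metis dvdI inverse_mult_eq_1')

text \<open>Here \<open>f = f\<^sub>0 (1 + g)\<close> with \<open>g\<close> free of a constant term.
  The right-hand side turns addition of exponents into multiplication and equals \<open>f\<close> at
  exponent 1.\<close>

lemma unit_powi_fps:
  fixes f :: "'a::field_char_0 fps"
  assumes "f $ 0 \<noteq> 0"
  defines "g \<equiv> fps_const (inverse (f $ 0)) * (f - fps_const (f $ 0))"
  shows "unit_powi f r = fps_const ((f $ 0) powi r) * (fps_binomial (of_int r) oo g)"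
proof -
  define G where "G r = fps_const ((f $ 0) powi r) * (fps_binomial (of_int r) oo g)" for r :: int
  \<comment> \<open>A vanishing constant term makes composition with \<open>g\<close>
    multiplicative.\<close>
  have "g $ 0 = 0"
    by (simp add: g_def)
  then have add: "G (d + e) = G d * G e" for d e
    using assms
    by (simp add: G_def power_int_add fps_binomial_add_mult fps_compose_mult_distrib mult_ac
        flip: fps_const_mult)
  have zero: "G 0 = 1"
    by (simp add: G_def)
  have "f = fps_const (f $ 0) * (1 + g)"
    using assms by (simp add: g_def algebra_simps mult.assoc [symmetric])
  also have "1 + g = fps_binomial 1 oo g"
    using \<open>g $ 0 = 0\<close> by (simp add: fps_binomial_1 fps_compose_add_distrib fps_X_fps_compose_startby0)
  finally have one: "G 1 = f"
    unfolding G_def by simp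
  show ?thesis
    using homomorphism_eq_unit_powi[of G r, OF add zero] unfolding one by (simp add: G_def)
qed

text \<open>If \<open>1 \<le> k\<close> or \<open>n \<le> 0\<close>, one side has a non-negative
  upper index and the other a negative one; symmetry and negation of the upper index connect
  them.\<close>

lemma ibinom_reflect:
  assumes "k \<le> n"
  shows "(ibinom (n - 1) (k - 1) :: 'a::field_char_0) = (- 1) ^ nat (n - k) * ibinom (- k) (- n)"
proof -
  consider "1 \<le> k" | "k \<le> 0" "1 \<le> n" | "n \<le> 0"
    using assms by linarith
  then show ?thesis
  proof cases
    case 1
    with assms obtain a b where ab: "k = int a + 1" "n = int a + int b + 1"
      by (metis add.assoc add.commute add.left_commute zle_iff_zadd)
    have "ibinom (n - 1) (k - 1) = (of_nat ((a + b) choose a) :: 'a)"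
      by (simp add: ibinom_def ab binomial_gbinomial)
    also have "\<dots> = of_nat ((a + b) choose b)"
      by (simp add: binomial_symmetric[of a "a + b"])
    also have "\<dots> = (- 1) ^ b * ((- of_int k) gchoose b)"
      using gbinomial_negated_upper[of "of_nat (a + b) :: 'a" b] by (simp add: ab binomial_gbinomial)
    finally show ?thesis
      by (simp add: ibinom_def ab)
  next
    \<comment> \<open>On both sides the lower index is negative and the upper one is not, so both
      values are 0 by convention.\<close>
    case 2
    then show ?thesis
      by (simp add: ibinom_def)
  next
    case 3
    with assms obtain a b where ab: "n = - int a" "k = - int a - int b"
      by (metis add.inverse_inverse add_diff_cancel_left' minus_diff_eq neg_0_le_iff_le nonneg_int_cases zle_iff_zadd diff_minus_eq_add uminus_add_conv_diff)
    have "ibinom (- k) (- n) = (of_nat ((a + b) choose a) :: 'a)"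
      by (simp add: ibinom_def ab binomial_gbinomial add.commute)
    also have "\<dots> = of_nat ((a + b) choose b)"
      by (simp add: binomial_symmetric[of a "a + b"])
    finally have "ibinom (- k) (- n) = (of_nat (a + b) gchoose b :: 'a)"
      by (simp add: binomial_gbinomial)
    moreover have "ibinom (n - 1) (k - 1) = (of_int (n - 1) gchoose b :: 'a)"
      by (simp add: ibinom_def ab)
    moreover have "\<dots> = (- 1) ^ b * (of_nat (a + b) gchoose b)"
      by (subst gbinomial_negated_upper) (simp add: ab add_ac)
    ultimately show ?thesis
      by (simp add: ab)
  qed
qed


section \<open>Potential polynomials\<close>

text \<open>The boundary values are instances of the general sum: for \<open>n = k = 0\<close> it
  runs over the zero function alone, otherwise over the empty set.\<close>

lemma bell_eq_sum:
  "bell n k = (\<Sum>r\<in>bell_exponents n k.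
    const (fact n / (\<Prod>i=1..n. fact (r i) * fact i ^ r i)) * (\<Prod>i=1..n. Xvar i ^ r i))"
proof -
  consider "n = 0" "k = 0" | "k = 0" "n \<noteq> 0" | "n < k" | "0 < k" "k \<le> n"
    by linarith
  then show ?thesis
  proof cases
    case 1
    have "bell_exponents 0 0 = {\<lambda>_. 0}"
      by (auto simp: bell_exponents_def)
    with 1 show ?thesis
      by (simp add: bell_def const_def)
  next
    case 2
    then have "bell_exponents n k = {}"
      by (auto simp: bell_exponents_def)
    with 2 show ?thesis
      by (simp add: bell_def)
  next
    case 3
    have "(\<Sum>i=1..n. r i) \<le> (\<Sum>i=1..n. i * r i)" for r :: "nat \<Rightarrow> nat"
      by (rule sum_mono) simp
    with 3 have "bell_exponents n k = {}"
      by (auto simp: bell_exponents_def) (metis leD)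
    with 3 show ?thesis
      by (simp add: bell_def)
  qed (simp add: bell_def)
qed

lemma bell_in_lring: "bell n k \<in> lring S"
  unfolding bell_eq_sum by (intro lring_intros) simp

lemma potential_in_lring: "0 \<in> S \<Longrightarrow> potential m r \<in> lring S"
  unfolding potential_def by (auto intro!: lring_intros bell_in_lring)

locale coeff_field_hom = coeff_hom \<iota>
  for \<iota> :: "'k::field_char_0 \<Rightarrow> 'a::field_char_0"
begin

lemma hom_divide: "\<iota> (a / b) = \<iota> a / \<iota> b"
proof (cases "b = 0")
  case False
  then have "\<iota> b * \<iota> (inverse b) = 1"
    using hom_mult[of b "inverse b"] by simp
  then have "\<iota> (inverse b) = inverse (\<iota> b)"
    by (metis inverse_unique)
  then show ?thesis
    by (simp add: divide_inverse hom_mult)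
qed simp

lemma hom_fact: "\<iota> (fact n) = fact n"
  by (induction n) (simp_all add: hom_mult hom_add hom_of_nat)

text \<open>The exponential generating function of the Bell polynomials: the factors
  \<open>fact i ^ r i\<close> turn \<open>y i\<close> into the coefficients
  \<open>y i / fact i\<close>.\<close>

lemma lsubst_bell:
  fixes y :: "nat \<Rightarrow> 'a"
  shows "lsubst \<iota> y (bell m j) =
    fact m / fact j * (Abs_fps (\<lambda>i. if i = 0 then 0 else y i / fact i) ^ j) $ m"
proof -
  \<comment> \<open>Bell polynomials have no negative exponents, so no value has to be
    invertible.\<close>
  interpret coeff_hom_units \<iota> "{}" y
    by unfold_locales simp
  have "lsubst \<iota> y (bell m j) = (\<Sum>r\<in>bell_exponents m j.
      fact m / (\<Prod>i=1..m. fact (r i) * fact i ^ r i) * (\<Prod>i=1..m. y i ^ r i))"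
    unfolding bell_eq_sum lsubst_sum
    by (simp add: lsubst_mult lring_intros lsubst_const lsubst_prod lsubst_power lsubst_Xpow
        hom_divide hom_fact hom_prod hom_mult hom_power)
  also have "\<dots> = fact m * (\<Sum>r\<in>bell_exponents m j. \<Prod>i=1..m. (y i / fact i) ^ r i / fact (r i))"
    by (simp add: sum_distrib_left prod_dividef prod.distrib power_divide mult_ac)
  also have "\<dots> = fact m * (\<Sum>r\<in>bell_exponents m j.
      \<Prod>i=1..m. (if i = 0 then 0 else y i / fact i) ^ r i / fact (r i))"
    by (intro arg_cong2[of _ _ _ _ times] sum.cong prod.cong refl) auto
  finally show ?thesis
    by (simp add: fps_power_nth_bell_exponents)
qed

lemma lsubst_potential:
  fixes y :: "nat \<Rightarrow> 'a"
  assumes "y 0 \<noteq> 0"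
  shows "lsubst \<iota> y (potential (int m) r) =
    fact m * unit_powi (Abs_fps (\<lambda>i. y i / fact i)) r $ m"
proof -
  interpret coeff_hom_units \<iota> "{0}" y
    using assms by unfold_locales (simp add: dvd_field_iff)
  let ?f = "Abs_fps (\<lambda>i. y i / fact i)"
  let ?g = "Abs_fps (\<lambda>i. if i = 0 then 0 else y i / fact i)"
  have g: "?f - fps_const (y 0) = ?g"
    by (simp add: fps_eq_iff)
  have "lsubst \<iota> y (potential (int m) r) =
      (\<Sum>j=0..m. (\<Prod>i<j. of_int r - of_nat i) * y 0 powi (r - int j) *
        (fact m / fact j * (?g ^ j) $ m))"
    unfolding potential_def
    by (simp add: lsubst_sum lsubst_mult lring_intros bell_in_lring lsubst_const lsubst_Xpow
        lsubst_bell unit_powi_field hom_prod hom_minus hom_of_int hom_of_nat)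
  \<comment> \<open>The falling factorial over \<open>fact j\<close> is the binomial coefficient,
    and \<open>y 0 powi (r - int j)\<close> splits into \<open>y 0 powi r\<close> and the factor
    normalising the \<open>j\<close>-th power of the series \<open>?g\<close>.\<close>
  also have "\<dots> = (\<Sum>j=0..m. fact m * (y 0 powi r *
      ((of_int r gchoose j) * (inverse (y 0) ^ j * (?g ^ j) $ m))))"
    using assms
    by (intro sum.cong refl)
      (simp add: gbinomial_prod_rev atLeast0LessThan power_int_diff field_simps)
  also have "\<dots> = fact m * (fps_const (y 0 powi r) *
      (fps_binomial (of_int r) oo (fps_const (inverse (y 0)) * ?g))) $ m"
    by (simp add: fps_compose_nth power_mult_distrib fps_const_power sum_distrib_left)
  also have "\<dots> = fact m * unit_powi ?f r $ m"
    using unit_powi_fps[of ?f r] assms by (simp add: g)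
  finally show ?thesis .
qed

text \<open>The inner values are \<open>fact i\<close> times the coefficients of
  \<open>1 / f\<close>, so their exponential generating function is \<open>1 / f\<close>, whose
  power \<open>r\<close> is the power \<open>- r\<close> of \<open>f\<close>.\<close>

lemma lsubst_potential_reciprocal:
  fixes y :: "nat \<Rightarrow> 'a"
  assumes "y 0 \<noteq> 0"
  shows "lsubst \<iota> (\<lambda>i. lsubst \<iota> y (reciprocal (int i))) (potential (int m) r) =
    lsubst \<iota> y (potential (int m) (- r))"
proof -
  define f where "f = Abs_fps (\<lambda>i. y i / fact i)"
  have f: "f dvd 1"
    using assms by (intro fps_dvd_1) (simp add: f_def)
  have rec: "lsubst \<iota> y (reciprocal (int i)) = fact i * unit_inv f $ i" for i
    by (simp add: reciprocal_def lsubst_potential assms f_def)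
  \<comment> \<open>The second use of \<open>lsubst_potential\<close>, for \<open>1 / f\<close>,
    requires a nonzero constant term.\<close>
  have "f $ 0 * unit_inv f $ 0 = 1"
    using arg_cong[OF mult_unit_inv[OF f], of "\<lambda>g. g $ 0"] by simp
  then have "unit_inv f $ 0 \<noteq> 0"
    by auto
  then show ?thesis
    using assms f
    by (simp add: lsubst_potential rec fps_nth_inverse unit_powi_uminus flip: f_def)
qed

end

section \<open>Passage to rational functions and shifted variables\<close>

instance fract :: ("{idom, ring_char_0}") ring_char_0
proof
  have "of_nat n = (to_fract (of_nat n) :: 'a fract)" for n
    by (induction n) simp_all
  then show "inj (of_nat :: nat \<Rightarrow> 'a fract)"
    by (auto simp: inj_on_def)
qed

text \<open>Power series with rational function coefficients are divided by factorials, so the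
  fraction field must have characteristic zero.\<close>

instance fract :: ("{idom, ring_char_0}") field_char_0 ..

lemma coeff_hom_const: "coeff_hom (const :: 'k::field_char_0 \<Rightarrow> 'k lpoly)"
  by unfold_locales (simp_all add: const_def single_add mult_single)

lemma coeff_field_hom_to_fract_const:
  "coeff_field_hom (\<lambda>c :: 'k::field_char_0. to_fract (const c))"
proof -
  interpret coeff_hom "const :: 'k \<Rightarrow> 'k lpoly"
    by (rule coeff_hom_const)
  show ?thesis
    by unfold_locales (simp_all add: hom_add hom_mult)
qed

lemma Xpow_add: "Xpow i d * Xpow i e = Xpow i (d + e)"
  by (simp add: Xpow_def mult_single single_add)

lemma Xpow_0: "Xpow i 0 = 1"
  by (simp add: Xpow_def)

lemma shift_div_in_lring: "shift_div i \<in> lring S"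
  by (auto simp: shift_div_def intro!: lring_intros)

lemma shift_div_0_unit: "shift_div 0 * Xpow 1 (- 1) = 1"
  by (simp add: shift_div_def const_def Xpow_add Xpow_0)

text \<open>Collapsing the nested substitutions expresses both families by potential polynomials at
  the same values \<open>y\<close>, with \<open>y i = h (i + 1) / (i + 1)\<close>.\<close>

lemma subst_rat_shift_div:
  fixes h :: "nat \<Rightarrow> 'k::field_char_0 ratfun"
  assumes "h 1 \<noteq> 0"
  defines "y \<equiv> \<lambda>i. subst_rat h (shift_div i)"
  shows "y 0 \<noteq> 0"
    and "subst_rat h (Bpoly n k) =
      to_fract (const (ibinom n k)) * subst_rat y (potential (n - k) k)"
    and "subst_rat h (Apoly n k) = to_fract (const (ibinom (n - 1) (k - 1))) *
      subst_rat (\<lambda>i. subst_rat y (reciprocal (int i))) (potential (n - k) n)"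
proof -
  interpret coeff_field_hom "\<lambda>c :: 'k. to_fract (const c)"
    by (rule coeff_field_hom_to_fract_const)
  \<comment> \<open>The shift sends \<open>X\<^sub>0\<close> to \<open>X\<^sub>1\<close>, so
    negative exponents are now confined to index 1.\<close>
  interpret coeff_hom_units "\<lambda>c :: 'k. to_fract (const c)" "{1}" h
    using assms by unfold_locales (simp add: dvd_field_iff)
  interpret shift: coeff_hom_units "const :: 'k \<Rightarrow> 'k lpoly" "{0}" shift_div
    using shift_div_0_unit
    by (intro coeff_hom_units.intro coeff_hom_const coeff_hom_units_axioms.intro) (auto intro: dvdI)
  let ?R = "\<lambda>i. subst_poly shift_div (reciprocal (int i)) :: 'k lpoly"
  have X: "(Xpow 1 (- 1) :: 'k lpoly) \<in> lring {1}"
    by (intro lring_Xpow) simp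
  have "y 0 * subst_rat h (Xpow 1 (- 1)) = subst_rat h (shift_div 0 * Xpow 1 (- 1))"
    using X by (simp add: y_def subst_rat_def lsubst_mult shift_div_in_lring)
  then show "y 0 \<noteq> 0"
    unfolding shift_div_0_unit by (auto simp: subst_rat_def lsubst_1)
  have shift_unit: "\<exists>P'\<in>lring {1}. shift_div i * P' = (1 :: 'k lpoly)" if "i \<in> {0}" for i
    using that X shift_div_0_unit by auto
  have sub: "subst_poly shift_div P \<in> lring {1}"
    "subst_rat h (subst_poly shift_div P) = subst_rat y P" if "P \<in> lring {0}" for P :: "'k lpoly"
    using lsubst_subst_poly[OF shift_div_in_lring shift_unit that] by (simp_all add: subst_rat_def y_def)
  note pot = potential_in_lring[of "{0}", simplified]
  show "subst_rat h (Bpoly n k) =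
      to_fract (const (ibinom n k)) * subst_rat y (potential (n - k) k)"
    using sub[OF pot, of "n - k" k]
    by (simp add: Bpoly_def subst_rat_def lsubst_mult lring_const lsubst_const)
  have R: "?R i \<in> lring {1}" "subst_rat h (?R i) = subst_rat y (reciprocal (int i))" for i
    unfolding reciprocal_def by (rule sub[OF pot])+
  \<comment> \<open>The outer potential polynomial has negative powers of its variable 0, which
    receives \<open>?R 0\<close>. Since this is \<open>1 / X\<^sub>1\<close>, its inverse is
    \<open>shift_div 0\<close>.\<close>
  have "reciprocal 0 = (Xpow 0 (- 1) :: 'k lpoly)"
    by (simp add: reciprocal_def potential_def bell_def const_def)
  then have "?R 0 * shift_div 0 = subst_poly shift_div (Xpow 0 (- 1) * Xpow 0 1)"
    unfolding subst_poly_def by (subst shift.lsubst_mult) (auto simp: lring_Xpow shift.lsubst_Xpow)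
  also have "\<dots> = 1"
    by (simp add: Xpow_add Xpow_0 subst_poly_def shift.lsubst_1)
  finally have R_unit: "\<exists>P'\<in>lring {1}. ?R i * P' = 1" if "i \<in> {0}" for i
    using that shift_div_in_lring by auto
  show "subst_rat h (Apoly n k) = to_fract (const (ibinom (n - 1) (k - 1))) *
      subst_rat (\<lambda>i. subst_rat y (reciprocal (int i))) (potential (n - k) n)"
    using lsubst_subst_poly[of ?R "{0}", OF R(1) R_unit pot[of "n - k" n]] R(2)
    by (simp add: Apoly_def subst_rat_def lsubst_mult lring_const lsubst_const)
qed

theorem theorem8p3:
  fixes Q :: "nat \<Rightarrow> nat \<Rightarrow> 'k::field_char_0 lpoly"
  assumes "B_representable Q"
    and "regular Q"
  shows "\<forall>n k :: int. Q_perp Q n k = (- 1) powi (n - k) * Q_ext Q (- k) (- n)"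
proof (intro allI)
  fix n k :: int
  interpret coeff_field_hom "\<lambda>c :: 'k. to_fract (const c)"
    by (rule coeff_field_hom_to_fract_const)
  \<comment> \<open>Regularity at size 1 is exactly the invertibility of \<open>Q 1 1\<close> in the
    fraction field.\<close>
  have "det (lower_matrix Q 1) = Q 1 1"
    by (subst det_single) (simp_all add: lower_matrix_def)
  then have "to_fract (Q 1 1) \<noteq> 0"
    using assms(2) by (auto simp: regular_def)
  note shift = subst_rat_shift_div[of "\<lambda>j. to_fract (Q j 1)", OF this]
  show "Q_perp Q n k = (- 1) powi (n - k) * Q_ext Q (- k) (- n)"
  proof (cases "k \<le> n")
    case True
    define m where "m = nat (n - k)"
    with True have m: "n - k = int m"
      by simp
    \<comment> \<open>The Bell side at \<open>(- k, - n)\<close> thus has the same order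
      \<open>m\<close>, and exponent \<open>- n\<close> in place of \<open>n\<close>.\<close>
    then have "- k - - n = int m"
      by simp
    then show ?thesis
      using lsubst_potential_reciprocal[of "\<lambda>i. subst_rat (\<lambda>j. to_fract (Q j 1)) (shift_div i)", OF shift(1), of m n, folded subst_rat_def] ibinom_reflect[OF True, where 'a = 'k]
      unfolding Q_perp_def Q_ext_def shift(2,3) m
      by (simp add: hom_mult hom_power hom_uminus)
  next
    \<comment> \<open>Both potential polynomials have the negative order \<open>n - k\<close>, hence
      vanish.\<close>
    case False
    then show ?thesis
      unfolding Q_perp_def Q_ext_def shift(2,3) by (simp add: potential_def subst_rat_def lsubst_0)
  qed
qed

end
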